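(* Suppose the joint distribution of $(\tilde{\mathbf c},\tilde{\mathbf P})$ is finitely supported, with scenarios $s\in\mathcal S=\{1,\dots,n\}$, realizations $(\tilde{\mathbf c}^s,\tilde{\mathbf P}^s)$ and probabilities $p^1,\dots,p^n$, and suppose the policy space is restricted to the set $\Pi_D$ of stationary deterministic policies. Consider the chance-constrained problem $$\text{(CCP)}\quad \min_{y\in\mathbb R,\ \boldsymbol\pi\in\Pi_D,\ \mathbf v}\ y\quad\text{s.t.}\quad \mathbb P_{\tilde{\mathbf c},\tilde{\mathbf P}}\Big(\sum_{i\in\mathcal H} q_i v_i^{(\tilde{\mathbf c},\tilde{\mathbf P})}\le y\Big)\ge\alpha,\qquad v_i^{(\tilde{\mathbf c},\tilde{\mathbf P})}=\tilde c_i(\pi_i)+\gamma\sum_{j\in\mathcal H}\tilde P_{ij}(\pi_i)\,v_j^{(\tilde{\mathbf c},\tilde{\mathbf P})}\quad (i\in\mathcal H),$$ where the policy $\boldsymbol\pi$ is the same for all realizations and $\mathbf v^{(\tilde{\mathbf c},\tilde{\mathbf P})}$ depends on the realization. Then (CCP) can be restated as the deterministic equivalent problem $$\text{(QMDP-D)}\quad \min\ y$$ over $y\in\mathbb R$, $w_{ia}$ ($i\in\mathcal H,a\in\mathcal A$), $v_i^s\in\mathbb R$ ($i\in\mathcal H$, $s\in\mathcal S$), $z^s$ ($s\in\mathcal S$), subject to $$\sum_{a\in\mathcal A}w_{ia}=1\ \ (i\in\mathcal H),\qquad \sum_{s\in\mathcal S}z^sp^s\ge\alpha,\qquad \sum_{i\in\mathcal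 H}q_iv_i^s\le y+(1-z^s)M\ \ (s\in\mathcal S),$$ $$v_i^s\ge\sum_{a\in\mathcal A}\tilde c_i^s(a)w_{ia}+\gamma\sum_{a\in\mathcal A}\sum_{j\in\mathcal H}\tilde P_{ij}^s(a)\,v_j^s\,w_{ia}\ \ (i\in\mathcal H,\ s\in\mathcal S),$$ $$z^s\in\{0,1\}\ (s\in\mathcal S),\qquad w_{ia}\in\{0,1\}\ (i\in\mathcal H,\ a\in\mathcal A),$$ where $M$ is a large number such that the constraint $\sum_{i}q_iv_i^s\le y+(1-z^s)M$ is redundant when $z^s=0$. That is, identifying a policy $\boldsymbol\pi\in\Pi_D$ with the $0/1$ array $\mathbf w$ in which $w_{ia}=1$ exactly when action $a$ is selected in state $i$, a pair $(y,\boldsymbol\pi)$ extends to a feasible solution of (CCP) if and only if $(y,\mathbf w)$ extends to a feasible solution of (QMDP-D); in particular the two problems have the same optimal value and the same optimal policies.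
   Context: An infinite-horizon discounted Markov decision process has a finite state space $\mathcal H$, a finite action space $\mathcal A$, discount factor $\gamma\in[0,1)$ and initial state distribution $\mathbf q=(q_i)_{i\in\mathcal H}$ (a probability vector). $\tilde c_i(a)$ is the immediate expected cost of action $a$ in state $i$, and $\tilde P_{ij}(a)$ is the probability of moving from $i$ to $j$ under action $a$ (so $\tilde P_{ij}(a)\ge 0$ and $\sum_j\tilde P_{ij}(a)=1$). All these parameters are nonnegative, stationary and bounded. The parameters $(\tilde{\mathbf c},\tilde{\mathbf P})$ are random; $\tilde{c}_i^s(a),\tilde P_{ij}^s(a)$ denote their values in scenario $s$, which has probability $p^s\geq 0$, $\sum_s p^s=1$. The confidence level is $\alpha\in(0,1]$. A stationary deterministic policy $\boldsymbol\pi=(\pi_i)_{i\in\mathcal H}\in\Pi_D$ selects one action in each state: each $\pi_i=(w_{ia})_{a\in\mathcal A}$ is a unit vector whose only nonzero entry (equal to $1$) is at the selected action. For such a policy, $\tilde c_i(\pi_i)=\sum_a w_{ia}\tilde c_i(a)$ and $\tilde P_{ij}(\pi_i)=\sum_a w_{ia}\tilde P_{ij}(a)$. For a policy $\boldsymbol\pi$ and scenario $s$, the Bellman equations $v_i=\tilde c^s_i(\pi_i)+\gamma\sum_j\tilde P^s_{ij}(\pi_i)v_j$ have a unique solution $\mathbf v$, and $C(\boldsymbol\pi,\tilde{\mathbf c}^s,\tilde{\mathbf P}^s)=\sum_i q_iv_i$ is the expected total discounted cost. Meaning of "$M$ makes the constraint redundant when $z^s=0$": $M$ is a real constant such that $C(\boldsymbol\pi,\tilde{\mathbf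 c}^s,\tilde{\mathbf P}^s)\le y+M$ for every $s\in\mathcal S$ and every $(y,\boldsymbol\pi)$, $\boldsymbol\pi\in\Pi_D$, that is feasible for (CCP), i.e. with $\sum_{s':\,C(\boldsymbol\pi,\tilde{\mathbf c}^{s'},\tilde{\mathbf P}^{s'})\le y}p^{s'}\ge\alpha$. *)

theory Defs
  imports "HOL-Probability.Probability"
begin

text \<open>States and actions are the elements of finite types \<open>'h\<close> and \<open>'a\<close>. A realization of the
  random parameters is a pair of the costs \<open>c i a\<close> and the transition probabilities \<open>P i a j\<close>
  (from state \<open>i\<close> to state \<open>j\<close> under action \<open>a\<close>).\<close>

type_synonym ('h, 'a) realization = "('h \<Rightarrow> 'a \<Rightarrow> real) \<times> ('h \<Rightarrow> 'a \<Rightarrow> 'h \<Rightarrow> real)"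

text \<open>A stationary deterministic policy is itself the array \<open>w i a\<close> whose rows are unit vectors, so
  identifying policies with 0/1 arrays is the identity map.\<close>

definition det_policies :: "('h \<Rightarrow> 'a \<Rightarrow> real) set" where
  "det_policies = {w. \<forall>i. \<exists>a. w i = (\<lambda>b. if b = a then 1 else 0)}"

definition policy_cost :: "('h \<Rightarrow> 'a::finite \<Rightarrow> real) \<Rightarrow> ('h \<Rightarrow> 'a \<Rightarrow> real) \<Rightarrow> 'h \<Rightarrow> real" where
  "policy_cost c w i = (\<Sum>a\<in>UNIV. w i a * c i a)"

definition policy_trans ::
  "('h \<Rightarrow> 'a::finite \<Rightarrow> 'h \<Rightarrow> real) \<Rightarrow> ('h \<Rightarrow> 'a \<Rightarrow> real) \<Rightarrow> 'h \<Rightarrow> 'h \<Rightarrow> real" where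
  "policy_trans P w i j = (\<Sum>a\<in>UNIV. w i a * P i a j)"

definition bellman ::
  "real \<Rightarrow> ('h::finite, 'a::finite) realization \<Rightarrow> ('h \<Rightarrow> 'a \<Rightarrow> real) \<Rightarrow> ('h \<Rightarrow> real) \<Rightarrow> bool" where
  "bellman \<gamma> r w v \<longleftrightarrow>
     (\<forall>i. v i = policy_cost (fst r) w i + \<gamma> * (\<Sum>j\<in>UNIV. policy_trans (snd r) w i j * v j))"

definition discounted_cost ::
  "('h \<Rightarrow> real) \<Rightarrow> real \<Rightarrow> ('h::finite \<Rightarrow> 'a::finite \<Rightarrow> real) \<Rightarrow> ('h, 'a) realization \<Rightarrow> real" where
  "discounted_cost q \<gamma> w r = (\<Sum>i\<in>UNIV. q i * (THE v. bellman \<gamma> r w v) i)"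

text \<open>\<open>D\<close> is the joint distribution of the random parameters; \<open>v r\<close> is the value vector for
  realization \<open>r\<close>, whereas \<open>y\<close> and \<open>w\<close> are common to all realizations.\<close>

definition CCP ::
  "('h \<Rightarrow> real) \<Rightarrow> real \<Rightarrow> real \<Rightarrow> ('h::finite, 'a::finite) realization pmf \<Rightarrow>
   (real \<times> ('h \<Rightarrow> 'a \<Rightarrow> real) \<times> (('h, 'a) realization \<Rightarrow> 'h \<Rightarrow> real)) set" where
  "CCP q \<gamma> \<alpha> D = {(y, w, v).
     w \<in> det_policies \<and>
     measure_pmf.prob D {r. (\<Sum>i\<in>UNIV. q i * v r i) \<le> y} \<ge> \<alpha> \<and>
     (\<forall>r\<in>set_pmf D. bellman \<gamma> r w (v r))}"

definition QMDP_D ::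
  "('h \<Rightarrow> real) \<Rightarrow> real \<Rightarrow> real \<Rightarrow> nat \<Rightarrow> (nat \<Rightarrow> 'h::finite \<Rightarrow> 'a::finite \<Rightarrow> real) \<Rightarrow>
   (nat \<Rightarrow> 'h \<Rightarrow> 'a \<Rightarrow> 'h \<Rightarrow> real) \<Rightarrow> (nat \<Rightarrow> real) \<Rightarrow> real \<Rightarrow>
   (real \<times> ('h \<Rightarrow> 'a \<Rightarrow> real) \<times> (nat \<Rightarrow> 'h \<Rightarrow> real) \<times> (nat \<Rightarrow> real)) set" where
  "QMDP_D q \<gamma> \<alpha> n c P p M = {(y, w, v, z).
     (\<forall>i. (\<Sum>a\<in>UNIV. w i a) = 1) \<and>
     (\<Sum>s\<in>{1..n}. z s * p s) \<ge> \<alpha> \<and>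
     (\<forall>s\<in>{1..n}. (\<Sum>i\<in>UNIV. q i * v s i) \<le> y + (1 - z s) * M) \<and>
     (\<forall>s\<in>{1..n}. \<forall>i. v s i \<ge> (\<Sum>a\<in>UNIV. c s i a * w i a)
         + \<gamma> * (\<Sum>a\<in>UNIV. \<Sum>j\<in>UNIV. P s i a j * v s j * w i a)) \<and>
     (\<forall>s\<in>{1..n}. z s \<in> {0, 1}) \<and>
     (\<forall>i a. w i a \<in> {0, 1})}"

text \<open>Redundancy is required only at the pairs \<open>(y, w)\<close> feasible for the chance-constrained
  problem, not for all real \<open>y\<close> (for which no such \<open>M\<close> exists).\<close>

definition redundant_M ::
  "('h \<Rightarrow> real) \<Rightarrow> real \<Rightarrow> real \<Rightarrow> nat \<Rightarrow> (nat \<Rightarrow> 'h::finite \<Rightarrow> 'a::finite \<Rightarrow> real) \<Rightarrow>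
   (nat \<Rightarrow> 'h \<Rightarrow> 'a \<Rightarrow> 'h \<Rightarrow> real) \<Rightarrow> (nat \<Rightarrow> real) \<Rightarrow> real \<Rightarrow> bool" where
  "redundant_M q \<gamma> \<alpha> n c P p M \<longleftrightarrow>
     (\<forall>y. \<forall>w\<in>det_policies.
        (\<Sum>s\<in>{s\<in>{1..n}. discounted_cost q \<gamma> w (c s, P s) \<le> y}. p s) \<ge> \<alpha> \<longrightarrow>
        (\<forall>s\<in>{1..n}. discounted_cost q \<gamma> w (c s, P s) \<le> y + M))"

text \<open>In both problems a feasible point is a tuple \<open>(y, w, u)\<close> with objective value \<open>y\<close>, array \<open>w\<close>
  and remaining variables \<open>u\<close>. The optimal value is extended real, so the infimum is meaningful for
  every feasible set.\<close>

definition optimal_value :: "(real \<times> 'w \<times> 'u) set \<Rightarrow> ereal" where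
  "optimal_value F = (INF x\<in>F. ereal (fst x))"

definition optimal_policies :: "(real \<times> 'w \<times> 'u) set \<Rightarrow> 'w set" where
  "optimal_policies F = {w. \<exists>y u. is_arg_min fst (\<lambda>x. x \<in> F) (y, w, u)}"

end

theory Submission imports Defs begin

text \<open>
  Fix a policy \<open>w\<close> in \<^const>\<open>det_policies\<close>. Its transition matrix is stochastic, and a discounted
  stochastic matrix obeys a minimum principle (\<open>discounted_superharmonic_nonneg\<close>): a vector \<open>d\<close>
  with \<open>d \<ge> \<gamma> Q d\<close> is nonnegative. This one fact gives everything needed about the Bellman
  equations: applied to \<open>\<plusminus>d\<close> it makes \<open>I - \<gamma> Q\<close> injective, hence bijective in finite dimension, so
  the value vector exists and is unique; applied to a difference it shows that every solution of the
  Bellman \<^emph>\<open>inequalities\<close> dominates the value vector, so with \<open>q \<ge> 0\<close> it overestimates the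
  discounted cost (\<open>discounted_cost_le_supersolution\<close>). This is why replacing \<open>=\<close> by \<open>\<ge>\<close> in the
  mixed-integer problem is harmless.

  The chance constraint for \<open>(y, w)\<close> says that the scenarios with discounted cost at most \<open>y\<close> carry
  mass at least \<open>\<alpha>\<close> (\<open>CCP_feasible_iff\<close>). Extendability of \<open>(y, w)\<close> to a feasible point of the
  mixed-integer problem is the same condition (\<open>QMDP_D_feasible_iff\<close>). In a feasible point, every
  scenario with \<open>z = 1\<close> has
  discounted cost at most \<open>y\<close> by domination, so these scenarios carry enough mass. Conversely, the
  true value vectors together with the indicator \<open>z\<close> of the scenarios of cost at most \<open>y\<close> are
  feasible; the choice of \<open>M\<close> enters exactly here, for the scenarios with \<open>z = 0\<close>.
  Optimal values and optimal policies depend only on the projection of the feasible set to the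
  pairs \<open>(y, w)\<close>, so they agree as well.
\<close>

section \<open>Discounted linear systems with a stochastic matrix\<close>

definition stochastic_matrix :: "('h::finite \<Rightarrow> 'h \<Rightarrow> real) \<Rightarrow> bool" where
  "stochastic_matrix Q \<longleftrightarrow> (\<forall>i j. 0 \<le> Q i j) \<and> (\<forall>i. (\<Sum>j\<in>UNIV. Q i j) = 1)"

text \<open>At an index \<open>k\<close> where \<open>d\<close> is smallest, the average \<open>\<Sum>j. Q k j * d j\<close> is at least \<open>d k\<close>, so
  \<open>d k \<ge> \<gamma> * d k\<close>, which forces \<open>d k \<ge> 0\<close> since \<open>\<gamma> < 1\<close>.\<close>

lemma discounted_superharmonic_nonneg:
  fixes Q :: "'h::finite \<Rightarrow> 'h \<Rightarrow> real" and d :: "'h \<Rightarrow> real"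
  assumes \<gamma>: "0 \<le> \<gamma>" "\<gamma> < 1"
    and Q: "stochastic_matrix Q"
    and d: "\<And>i. \<gamma> * (\<Sum>j\<in>UNIV. Q i j * d j) \<le> d i"
  shows "0 \<le> d i"
proof -
  have "Min (range d) \<in> range d" by (intro Min_in) auto
  then obtain k where k: "Min (range d) = d k" by (rule rangeE)
  have min: "d k \<le> d j" for j unfolding k[symmetric] by (intro Min_le) auto
  have "d k = (\<Sum>j\<in>UNIV. Q k j * d k)"
    using Q by (simp add: stochastic_matrix_def flip: sum_distrib_right)
  also have "\<dots> \<le> (\<Sum>j\<in>UNIV. Q k j * d j)"
    using Q by (intro sum_mono mult_left_mono min) (simp add: stochastic_matrix_def)
  finally have "\<gamma> * d k \<le> \<gamma> * (\<Sum>j\<in>UNIV. Q k j * d j)"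
    using \<gamma>(1) by (rule mult_left_mono)
  also have "\<dots> \<le> d k" by (rule d)
  finally have "0 \<le> (1 - \<gamma>) * d k" by (simp add: algebra_simps)
  then have "0 \<le> d k" using \<gamma>(2) by (simp add: zero_le_mult_iff)
  then show ?thesis using min[of i] by simp
qed

text \<open>A supersolution minus a subsolution is superharmonic.\<close>

lemma discounted_subsolution_le_supersolution:
  fixes Q :: "'h::finite \<Rightarrow> 'h \<Rightarrow> real" and b u v :: "'h \<Rightarrow> real"
  assumes \<gamma>: "0 \<le> \<gamma>" "\<gamma> < 1"
    and Q: "stochastic_matrix Q"
    and u: "\<And>i. u i \<le> b i + \<gamma> * (\<Sum>j\<in>UNIV. Q i j * u j)"
    and v: "\<And>i. b i + \<gamma> * (\<Sum>j\<in>UNIV. Q i j * v j) \<le> v i"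
  shows "u i \<le> v i"
proof -
  have "\<gamma> * (\<Sum>j\<in>UNIV. Q i j * (v j - u j)) \<le> v i - u i" for i
    using u[of i] v[of i] by (simp add: algebra_simps sum_subtractf)
  from discounted_superharmonic_nonneg[OF \<gamma> Q this, of i] show ?thesis by simp
qed

text \<open>Uniqueness is the comparison of solutions in both directions. For existence, uniqueness with
  \<open>b = 0\<close> says that the linear map \<open>x \<mapsto> x - \<gamma> Q x\<close> has trivial kernel, and an injective
  endomorphism of a finite-dimensional space is surjective.\<close>

lemma discounted_system_ex1:
  fixes Q :: "'h::finite \<Rightarrow> 'h \<Rightarrow> real" and b :: "'h \<Rightarrow> real"
  assumes \<gamma>: "0 \<le> \<gamma>" "\<gamma> < 1"
    and Q: "stochastic_matrix Q"
  shows "\<exists>!v. \<forall>i. v i = b i + \<gamma> * (\<Sum>j\<in>UNIV. Q i j * v j)"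
proof -
  have unique: "u = v"
    if "\<And>i. u i = b i + \<gamma> * (\<Sum>j\<in>UNIV. Q i j * u j)"
      and "\<And>i. v i = b i + \<gamma> * (\<Sum>j\<in>UNIV. Q i j * v j)" for u v b :: "'h \<Rightarrow> real"
  proof (rule ext, rule antisym)
    fix i
    show "u i \<le> v i"
      by (rule discounted_subsolution_le_supersolution[OF \<gamma> Q, of u b v,
            OF eq_refl[OF that(1)] eq_refl[OF that(2)[symmetric]]])
    show "v i \<le> u i"
      by (rule discounted_subsolution_le_supersolution[OF \<gamma> Q, of v b u,
            OF eq_refl[OF that(2)] eq_refl[OF that(1)[symmetric]]])
  qed
  define L :: "real^'h \<Rightarrow> real^'h"
    where "L x = (\<chi> i. x $ i - \<gamma> * (\<Sum>j\<in>UNIV. Q i j * x $ j))" for x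
  have lin: "linear L"
  proof (rule linearI)
    show "L (x + y) = L x + L y" for x y
      by (simp add: L_def vec_eq_iff distrib_left sum.distrib)
    show "L (r *\<^sub>R x) = r *\<^sub>R L x" for r x
    proof -
      have "(\<Sum>j\<in>UNIV. Q i j * (r * x $ j)) = r * (\<Sum>j\<in>UNIV. Q i j * x $ j)" for i
        unfolding sum_distrib_left by (simp only: mult.left_commute)
      then show ?thesis by (simp add: L_def vec_eq_iff right_diff_distrib)
    qed
  qed
  moreover have "inj L"
    unfolding linear_injective_0[OF lin]
  proof (intro allI impI)
    fix x assume "L x = 0"
    then have "L x $ i = 0" for i by simp
    then have "x $ i = 0 + \<gamma> * (\<Sum>j\<in>UNIV. Q i j * x $ j)" for i
      unfolding L_def vec_lambda_beta by (metis add_0 eq_iff_diff_eq_0)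
    from unique[of "($) x" "\<lambda>_. 0" "\<lambda>_. 0", OF this] show "x = 0"
      by (simp add: vec_eq_iff fun_eq_iff)
  qed
  ultimately have "surj L" by (rule linear_injective_imp_surjective) (rule refl)
  then obtain x where "L x = (\<chi> i. b i)" by (metis surjD)
  then have "L x $ i = b i" for i by simp
  then have "x $ i = b i + \<gamma> * (\<Sum>j\<in>UNIV. Q i j * x $ j)" for i
    unfolding L_def vec_lambda_beta by (metis diff_eq_eq)
  then show ?thesis using unique by blast
qed

section \<open>Value vectors of deterministic policies\<close>

lemma det_policies_eq_binary_arrays:
  "det_policies = {w :: 'h \<Rightarrow> 'a::finite \<Rightarrow> real.
     (\<forall>i. (\<Sum>a\<in>UNIV. w i a) = 1) \<and> (\<forall>i a. w i a \<in> {0, 1})}" (is "_ = ?B")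
proof (intro equalityI subsetI)
  fix w :: "'h \<Rightarrow> 'a \<Rightarrow> real" assume w: "w \<in> det_policies"
  have "(\<Sum>a\<in>UNIV. w i a) = 1 \<and> (\<forall>a. w i a \<in> {0, 1})" for i
  proof -
    from w obtain a where "w i = (\<lambda>b. if b = a then 1 else 0)"
      unfolding det_policies_def by blast
    then show ?thesis by simp
  qed
  then show "w \<in> ?B" by blast
next
  fix w :: "'h \<Rightarrow> 'a \<Rightarrow> real" assume w: "w \<in> ?B"
  have "\<exists>a. w i = (\<lambda>b. if b = a then 1 else 0)" for i
  proof -
    have bin: "w i b = 0 \<or> w i b = 1" for b using w by blast
    then have "w i b = of_bool (w i b = 1)" for b by (metis of_bool_eq(1) of_bool_eq(2))
    then have "(\<Sum>b\<in>UNIV. of_bool (w i b = 1)) = (\<Sum>b\<in>UNIV. w i b)"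
      by (intro sum.cong refl) (rule sym)
    then have "(\<Sum>b\<in>UNIV. of_bool (w i b = 1)) = (1::real)" using w by simp
    then have "card {b. w i b = 1} = 1" by simp
    then obtain a where "{b. w i b = 1} = {a}" by (rule card_1_singletonE)
    then have "w i b = (if b = a then 1 else 0)" for b
      using bin[of b] by auto
    then show ?thesis by blast
  qed
  then show "w \<in> det_policies" unfolding det_policies_def by blast
qed

definition transition_kernel :: "('h::finite \<Rightarrow> 'a \<Rightarrow> 'h \<Rightarrow> real) \<Rightarrow> bool" where
  "transition_kernel P \<longleftrightarrow> (\<forall>a. stochastic_matrix (\<lambda>i. P i a))"

lemma stochastic_policy_trans:
  fixes w :: "'h::finite \<Rightarrow> 'a::finite \<Rightarrow> real"
  assumes w: "w \<in> det_policies"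
    and P: "transition_kernel P"
  shows "stochastic_matrix (policy_trans P w)"
  unfolding stochastic_matrix_def
proof (intro conjI allI)
  fix i
  have "0 \<le> w i a" for a
  proof -
    have "w i a \<in> {0, 1}" using w unfolding det_policies_eq_binary_arrays by blast
    then show ?thesis by auto
  qed
  then show "0 \<le> policy_trans P w i j" for j
    using P unfolding policy_trans_def transition_kernel_def stochastic_matrix_def
    by (intro sum_nonneg mult_nonneg_nonneg) auto
  have "(\<Sum>j\<in>UNIV. policy_trans P w i j) = (\<Sum>a\<in>UNIV. w i a * (\<Sum>j\<in>UNIV. P i a j))"
    unfolding policy_trans_def by (subst sum.swap) (simp add: sum_distrib_left)
  also have "\<dots> = 1"
    using w P
    by (simp add: det_policies_eq_binary_arrays transition_kernel_def stochastic_matrix_def)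
  finally show "(\<Sum>j\<in>UNIV. policy_trans P w i j) = 1" .
qed

lemma bellman_ex1:
  fixes w :: "'h::finite \<Rightarrow> 'a::finite \<Rightarrow> real"
  assumes "0 \<le> \<gamma>" "\<gamma> < 1" and "w \<in> det_policies"
    and "transition_kernel P"
  shows "\<exists>!v. bellman \<gamma> (c, P) w v"
  unfolding bellman_def fst_conv snd_conv
  by (intro discounted_system_ex1 stochastic_policy_trans assms)

lemma bellman_The:
  fixes w :: "'h::finite \<Rightarrow> 'a::finite \<Rightarrow> real"
  assumes "0 \<le> \<gamma>" "\<gamma> < 1" and "w \<in> det_policies"
    and "transition_kernel P"
  shows "bellman \<gamma> (c, P) w (THE v. bellman \<gamma> (c, P) w v)"
  by (rule theI'[OF bellman_ex1[OF assms]])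

lemma discounted_cost_eq_bellman_solution:
  fixes w :: "'h::finite \<Rightarrow> 'a::finite \<Rightarrow> real"
  assumes "0 \<le> \<gamma>" "\<gamma> < 1" and "w \<in> det_policies"
    and "transition_kernel P"
    and "bellman \<gamma> (c, P) w v"
  shows "discounted_cost q \<gamma> w (c, P) = (\<Sum>i\<in>UNIV. q i * v i)"
proof -
  have "(THE u. bellman \<gamma> (c, P) w u) = v"
    using bellman_ex1[OF assms(1-4), of c] assms(5)
    by (rule the1_equality[where P = "bellman \<gamma> (c, P) w"])
  then show ?thesis by (simp add: discounted_cost_def)
qed

lemma QMDP_D_rhs_eq_bellman_rhs:
  fixes w :: "'h::finite \<Rightarrow> 'a::finite \<Rightarrow> real"
  shows "(\<Sum>a\<in>UNIV. c i a * w i a) + \<gamma> * (\<Sum>a\<in>UNIV. \<Sum>j\<in>UNIV. P i a j * v j * w i a)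
       = policy_cost c w i + \<gamma> * (\<Sum>j\<in>UNIV. policy_trans P w i j * v j)"
  unfolding policy_cost_def policy_trans_def sum_distrib_right
  by (subst (2) sum.swap) (simp add: mult_ac)

text \<open>The value vector is the least solution of the Bellman inequalities, and \<open>q \<ge> 0\<close> makes the
  expected cost monotone in the value vector.\<close>

lemma discounted_cost_le_supersolution:
  fixes w :: "'h::finite \<Rightarrow> 'a::finite \<Rightarrow> real"
  assumes mdp: "0 \<le> \<gamma>" "\<gamma> < 1" "w \<in> det_policies" "transition_kernel P"
    and q: "\<And>i. 0 \<le> q i"
    and v: "\<And>i. policy_cost c w i + \<gamma> * (\<Sum>j\<in>UNIV. policy_trans P w i j * v j) \<le> v i"
  shows "discounted_cost q \<gamma> w (c, P) \<le> (\<Sum>i\<in>UNIV. q i * v i)"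
proof -
  define u where "u = (THE u. bellman \<gamma> (c, P) w u)"
  have "bellman \<gamma> (c, P) w u" unfolding u_def by (rule bellman_The[OF mdp])
  then have "u i = policy_cost c w i + \<gamma> * (\<Sum>j\<in>UNIV. policy_trans P w i j * u j)" for i
    unfolding bellman_def fst_conv snd_conv by blast
  then have u: "u i \<le> policy_cost c w i + \<gamma> * (\<Sum>j\<in>UNIV. policy_trans P w i j * u j)" for i
    by (rule eq_refl)
  have "u i \<le> v i" for i
    using discounted_subsolution_le_supersolution[OF mdp(1,2)
        stochastic_policy_trans[OF mdp(3,4)], of u "policy_cost c w" v i] u v by blast
  then show ?thesis
    unfolding discounted_cost_def u_def[symmetric] by (intro sum_mono mult_left_mono q)
qed

section \<open>Projections of the two feasible sets\<close>

lemma set_pmf_finite_scenarios: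
  assumes "\<And>r. pmf D r = (\<Sum>s\<in>{s\<in>S. X s = r}. p s)"
  shows "set_pmf D \<subseteq> X ` S"
proof
  fix r assume "r \<in> set_pmf D"
  then have "{s\<in>S. X s = r} \<noteq> {}" using assms[of r] by (metis set_pmf_iff sum.empty)
  then show "r \<in> X ` S" by blast
qed

text \<open>Several scenarios may share a realization, so an event is summed over the fibres of \<open>X\<close>.\<close>

lemma prob_finite_scenarios:
  fixes X :: "'s \<Rightarrow> 'r"
  assumes S: "finite S" and D: "\<And>r. pmf D r = (\<Sum>s\<in>{s\<in>S. X s = r}. p s)"
  shows "measure_pmf.prob D A = (\<Sum>s\<in>{s\<in>S. X s \<in> A}. p s)"
proof -
  have "measure_pmf.prob D A = measure_pmf.prob D (A \<inter> X ` S)"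
    using set_pmf_finite_scenarios[where X = X, OF D]
    by (intro measure_pmf.finite_measure_eq_AE) (auto simp: AE_measure_pmf_iff)
  also have "\<dots> = (\<Sum>r\<in>A \<inter> X ` S. \<Sum>s\<in>{s\<in>{s\<in>S. X s \<in> A}. X s = r}. p s)"
    using S by (auto simp: measure_measure_pmf_finite D intro!: sum.cong)
  also have "\<dots> = (\<Sum>s\<in>{s\<in>S. X s \<in> A}. p s)"
    using S by (intro sum.group) auto
  finally show ?thesis .
qed

text \<open>The chance constraint only sees \<open>v\<close> on the support of \<open>D\<close>, where it must be the value vector;
  the finitely many scenarios cover the support.\<close>

lemma CCP_feasible_iff:
  fixes q :: "'h::finite \<Rightarrow> real"
    and c :: "nat \<Rightarrow> 'h \<Rightarrow> 'a::finite \<Rightarrow> real"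
  assumes \<gamma>: "0 \<le> \<gamma>" "\<gamma> < 1"
    and P: "\<And>s. s \<in> {1..n} \<Longrightarrow> transition_kernel (P s)"
    and D: "\<And>r. pmf D r = (\<Sum>s\<in>{s\<in>{1..n}. (c s, P s) = r}. p s)"
  shows "(\<exists>v. (y, w, v) \<in> CCP q \<gamma> \<alpha> D) \<longleftrightarrow>
    w \<in> det_policies \<and> \<alpha> \<le> (\<Sum>s\<in>{s\<in>{1..n}. discounted_cost q \<gamma> w (c s, P s) \<le> y}. p s)"
    (is "?L \<longleftrightarrow> ?R")
proof (cases "w \<in> det_policies")
  case w: True
  have scenario: "\<exists>s\<in>{1..n}. r = (c s, P s)" if "r \<in> set_pmf D" for r
    using set_pmf_finite_scenarios[where X = "\<lambda>s. (c s, P s)", OF D] that by blast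
  have chance: "measure_pmf.prob D {r. (\<Sum>i\<in>UNIV. q i * v r i) \<le> y}
      = (\<Sum>s\<in>{s\<in>{1..n}. discounted_cost q \<gamma> w (c s, P s) \<le> y}. p s)"
    if v: "\<forall>r\<in>set_pmf D. bellman \<gamma> r w (v r)" for v
  proof -
    have "discounted_cost q \<gamma> w r = (\<Sum>i\<in>UNIV. q i * v r i)" if r: "r \<in> set_pmf D" for r
    proof -
      from scenario[OF r] obtain s where s: "s \<in> {1..n}" "r = (c s, P s)" by blast
      show ?thesis
        using v r discounted_cost_eq_bellman_solution[OF \<gamma> w P[OF s(1)]] unfolding s(2) by blast
    qed
    then have "measure_pmf.prob D {r. (\<Sum>i\<in>UNIV. q i * v r i) \<le> y}
        = measure_pmf.prob D {r. discounted_cost q \<gamma> w r \<le> y}"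
      by (intro measure_pmf.finite_measure_eq_AE) (auto simp: AE_measure_pmf_iff)
    then show ?thesis by (simp add: prob_finite_scenarios[OF finite_atLeastAtMost D])
  qed
  show ?thesis
  proof
    assume ?L then show ?R using chance by (auto simp: CCP_def)
  next
    assume R: ?R
    define v where "v r = (THE v. bellman \<gamma> r w v)" for r
    have "\<forall>r\<in>set_pmf D. bellman \<gamma> r w (v r)"
      unfolding v_def using scenario bellman_The[OF \<gamma> w P] by blast
    with chance[OF this] R have "(y, w, v) \<in> CCP q \<gamma> \<alpha> D" by (simp add: CCP_def)
    then show ?L by blast
  qed
qed (simp add: CCP_def)

text \<open>The same criterion for the mixed-integer problem. From left to right, the variables \<open>v\<close> may
  lie strictly above the value vectors and \<open>z\<close> may vanish on scenarios of cost at most \<open>y\<close>; both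
  only lose mass, since \<open>p \<ge> 0\<close>. From right to left, the criterion is precisely the condition under
  which \<^const>\<open>redundant_M\<close> bounds the cost of every scenario by \<open>y + M\<close>.\<close>

lemma QMDP_D_feasible_iff:
  fixes q :: "'h::finite \<Rightarrow> real"
    and c :: "nat \<Rightarrow> 'h \<Rightarrow> 'a::finite \<Rightarrow> real"
  assumes \<gamma>: "0 \<le> \<gamma>" "\<gamma> < 1"
    and q: "\<And>i. 0 \<le> q i"
    and p: "\<And>s. s \<in> {1..n} \<Longrightarrow> 0 \<le> p s"
    and P: "\<And>s. s \<in> {1..n} \<Longrightarrow> transition_kernel (P s)"
    and M: "redundant_M q \<gamma> \<alpha> n c P p M"
  shows "(\<exists>v z. (y, w, v, z) \<in> QMDP_D q \<gamma> \<alpha> n c P p M) \<longleftrightarrow>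
    w \<in> det_policies \<and> \<alpha> \<le> (\<Sum>s\<in>{s\<in>{1..n}. discounted_cost q \<gamma> w (c s, P s) \<le> y}. p s)"
    (is "?L \<longleftrightarrow> ?R")
proof
  let ?C = "\<lambda>s. discounted_cost q \<gamma> w (c s, P s)"
  assume ?L
  then obtain v z where "(y, w, v, z) \<in> QMDP_D q \<gamma> \<alpha> n c P p M" by blast
  then have w: "w \<in> det_policies"
    and mass: "\<alpha> \<le> (\<Sum>s\<in>{1..n}. z s * p s)"
    and cost: "\<And>s. s \<in> {1..n} \<Longrightarrow> (\<Sum>i\<in>UNIV. q i * v s i) \<le> y + (1 - z s) * M"
    and super: "\<And>s i. s \<in> {1..n} \<Longrightarrow> policy_cost (c s) w i
      + \<gamma> * (\<Sum>j\<in>UNIV. policy_trans (P s) w i j * v s j) \<le> v s i"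
    and z: "\<And>s. s \<in> {1..n} \<Longrightarrow> z s \<in> {0, 1}"
    unfolding QMDP_D_def QMDP_D_rhs_eq_bellman_rhs det_policies_eq_binary_arrays by auto
  have "z s * p s \<le> (if ?C s \<le> y then p s else 0)" if s: "s \<in> {1..n}" for s
  proof (cases "z s = 0")
    case False
    then have "z s = 1" using z[OF s] by simp
    then have "?C s \<le> y"
      using discounted_cost_le_supersolution[where q = q and v = "v s",
          OF \<gamma> w P[OF s] q super[OF s]]
        cost[OF s] by simp
    then show ?thesis using \<open>z s = 1\<close> by simp
  qed (use p[OF s] in simp)
  then have "(\<Sum>s\<in>{1..n}. z s * p s) \<le> (\<Sum>s\<in>{1..n}. if ?C s \<le> y then p s else 0)"
    by (rule sum_mono)
  also have "\<dots> = (\<Sum>s\<in>{s\<in>{1..n}. ?C s \<le> y}. p s)"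
    by (rule sum.inter_filter[symmetric]) simp
  finally show ?R using w mass by linarith
next
  let ?C = "\<lambda>s. discounted_cost q \<gamma> w (c s, P s)"
  assume R: ?R
  then have w: "w \<in> det_policies" by blast
  define v where "v s = (THE v. bellman \<gamma> (c s, P s) w v)" for s
  define z :: "nat \<Rightarrow> real" where "z s = of_bool (?C s \<le> y)" for s
  have C: "(\<Sum>i\<in>UNIV. q i * v s i) = ?C s" for s
    by (simp add: discounted_cost_def v_def)
  have "?C s \<le> y + M" if "s \<in> {1..n}" for s
    using M R that unfolding redundant_M_def by blast
  then have "(\<Sum>i\<in>UNIV. q i * v s i) \<le> y + (1 - z s) * M" if "s \<in> {1..n}" for s
    using that by (simp add: C z_def)
  moreover have "policy_cost (c s) w i
      + \<gamma> * (\<Sum>j\<in>UNIV. policy_trans (P s) w i j * v s j) \<le> v s i" if "s \<in> {1..n}" for s i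
  proof -
    have "bellman \<gamma> (c s, P s) w (v s)" unfolding v_def by (rule bellman_The[OF \<gamma> w P[OF that]])
    then have "v s i = policy_cost (c s) w i
        + \<gamma> * (\<Sum>j\<in>UNIV. policy_trans (P s) w i j * v s j)"
      unfolding bellman_def fst_conv snd_conv by blast
    then show ?thesis by (rule eq_refl[OF sym])
  qed
  moreover have "(\<Sum>s\<in>{1..n}. z s * p s) = (\<Sum>s\<in>{s\<in>{1..n}. ?C s \<le> y}. p s)"
    unfolding sum.inter_filter[OF finite_atLeastAtMost] z_def by (intro sum.cong) auto
  ultimately have "(y, w, v, z) \<in> QMDP_D q \<gamma> \<alpha> n c P p M"
    using R w unfolding QMDP_D_def QMDP_D_rhs_eq_bellman_rhs det_policies_eq_binary_arrays
    by (auto simp: z_def)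
  then show ?L by blast
qed

section \<open>Optimality depends only on the projection\<close>

lemma optimal_value_cong_projection:
  fixes F :: "(real \<times> 'w \<times> 'u) set" and G :: "(real \<times> 'w \<times> 't) set"
  assumes "\<And>y w. (\<exists>u. (y, w, u) \<in> F) \<longleftrightarrow> (\<exists>t. (y, w, t) \<in> G)"
  shows "optimal_value F = optimal_value G"
proof -
  have "fst ` F = {y. \<exists>w u. (y, w, u) \<in> F}" "fst ` G = {y. \<exists>w t. (y, w, t) \<in> G}"
    by force+
  then have "fst ` F = fst ` G" using assms by auto
  then show ?thesis unfolding optimal_value_def by (metis image_image)
qed

text \<open>Minimality of \<open>(y, w, u)\<close> compares objective values only, so the remaining variables \<open>u\<close> occur
  in it only through feasibility.\<close>

lemma optimal_policies_eq_projection: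
  "optimal_policies F =
    {w. \<exists>y. (\<exists>u. (y, w, u) \<in> F) \<and> (\<forall>y' w'. (\<exists>u. (y', w', u) \<in> F) \<longrightarrow> \<not> y' < y)}"
  unfolding optimal_policies_def is_arg_min_def by fastforce

lemma optimal_policies_cong_projection:
  fixes F :: "(real \<times> 'w \<times> 'u) set" and G :: "(real \<times> 'w \<times> 't) set"
  assumes "\<And>y w. (\<exists>u. (y, w, u) \<in> F) \<longleftrightarrow> (\<exists>t. (y, w, t) \<in> G)"
  shows "optimal_policies F = optimal_policies G"
  unfolding optimal_policies_eq_projection assms ..

section \<open>The deterministic equivalent\<close>

theorem proposition2:
  fixes q :: "'h::finite \<Rightarrow> real"
    and \<gamma> \<alpha> M :: real
    and n :: nat
    and c :: "nat \<Rightarrow> 'h \<Rightarrow> 'a::finite \<Rightarrow> real"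
    and P :: "nat \<Rightarrow> 'h \<Rightarrow> 'a \<Rightarrow> 'h \<Rightarrow> real"
    and p :: "nat \<Rightarrow> real"
    and D :: "('h, 'a) realization pmf"
  assumes "0 \<le> \<gamma>" and "\<gamma> < 1"
    and "0 < \<alpha>" and "\<alpha> \<le> 1"
    and "\<forall>i. 0 \<le> q i" and "(\<Sum>i\<in>UNIV. q i) = 1"
    and "\<forall>s\<in>{1..n}. 0 \<le> p s" and "(\<Sum>s\<in>{1..n}. p s) = 1"
    and "\<forall>s\<in>{1..n}. \<forall>i a. 0 \<le> c s i a"
    and "\<forall>s\<in>{1..n}. \<forall>i a j. 0 \<le> P s i a j"
    and "\<forall>s\<in>{1..n}. \<forall>i a. (\<Sum>j\<in>UNIV. P s i a j) = 1"
    and "\<forall>r. pmf D r = (\<Sum>s\<in>{s\<in>{1..n}. (c s, P s) = r}. p s)"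
    and "redundant_M q \<gamma> \<alpha> n c P p M"
  shows "(\<forall>y w. (\<exists>v. (y, w, v) \<in> CCP q \<gamma> \<alpha> D) \<longleftrightarrow>
                (\<exists>v z. (y, w, v, z) \<in> QMDP_D q \<gamma> \<alpha> n c P p M))
       \<and> optimal_value (CCP q \<gamma> \<alpha> D) = optimal_value (QMDP_D q \<gamma> \<alpha> n c P p M)
       \<and> optimal_policies (CCP q \<gamma> \<alpha> D) = optimal_policies (QMDP_D q \<gamma> \<alpha> n c P p M)"
proof -
  have kernel: "transition_kernel (P s)" if "s \<in> {1..n}" for s
    using assms(10,11) that unfolding transition_kernel_def stochastic_matrix_def by blast
  have projection: "(\<exists>v. (y, w, v) \<in> CCP q \<gamma> \<alpha> D) \<longleftrightarrow>
      (\<exists>u. (y, w, u) \<in> QMDP_D q \<gamma> \<alpha> n c P p M)" for y w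
  proof -
    have "(\<exists>v z. (y, w, v, z) \<in> QMDP_D q \<gamma> \<alpha> n c P p M) \<longleftrightarrow>
        w \<in> det_policies \<and>
        \<alpha> \<le> (\<Sum>s\<in>{s\<in>{1..n}. discounted_cost q \<gamma> w (c s, P s) \<le> y}. p s)"
      by (rule QMDP_D_feasible_iff[OF assms(1,2) _ _ kernel assms(13)]) (use assms(5,7) in blast)+
    moreover have "(\<exists>v. (y, w, v) \<in> CCP q \<gamma> \<alpha> D) \<longleftrightarrow>
        w \<in> det_policies \<and>
        \<alpha> \<le> (\<Sum>s\<in>{s\<in>{1..n}. discounted_cost q \<gamma> w (c s, P s) \<le> y}. p s)"
      by (rule CCP_feasible_iff[OF assms(1,2) kernel assms(12)[rule_format]])
    ultimately show ?thesis by auto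
  qed
  show ?thesis
    using projection optimal_value_cong_projection[OF projection]
      optimal_policies_cong_projection[OF projection]
    by simp
qed

end
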